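(* The functional $S:\hat\Lambda\to\mathbb R$ defined by $$S(\gamma_t)=\begin{cases}\dfrac{(\|\gamma_t\|_0^6-|\gamma_t(t)|^6)^3}{\|\gamma_t\|_0^{12}},&\|\gamma_t\|_0\ne0,\\ 0,&\|\gamma_t\|_0=0,\end{cases}\qquad (t,\gamma_t)\in[0,T]\times\hat\Lambda,$$ belongs to $C^{1,2}_p(\hat\Lambda)$. Moreover, for every $M\ge1$, the functional $\Upsilon^M(\gamma_t)=S(\gamma_t)+M|\gamma_t(t)|^6$ satisfies $$\frac{8}{27}\|\gamma_t\|_0^6\le\Upsilon^M(\gamma_t)\le(M+1)\|\gamma_t\|_0^6,\qquad (t,\gamma_t)\in[0,T]\times\hat\Lambda.$$
   Context: $H$ is a real separable Hilbert space with norm $|\cdot|$; $\mathcal S(H)$ is the space of bounded self-adjoint operators on $H$ with the operator norm. $T>0$ is fixed. $A$ generates a strongly continuous semigroup $\{e^{sA}\}_{s\ge0}$ of bounded linear operators on $H$. $\hat\Lambda_t=D([0,t];H)$ (càdlàg paths), $\hat\Lambda=\bigcup_{t\in[0,T]}\hat\Lambda_t$. An element of $\hat\Lambda_t$ is written $\gamma_t$, with value $\gamma_t(s)$ at time $s$; "$(t,\gamma_t)\in[0,T]\times\hat\Lambda$" means $\gamma_t\in\hat\Lambda_t$. For $x\in H$, $\gamma_t\in\hat\Lambda_t$, $t\le s\le T$: $\gamma_t^x$ equals $\gamma_t$ on $[0,t)$ and $\gamma_t^x(t)=\gamma_t(t)+x$; $\gamma_{t,s}\in\hat\Lambda_s$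 equals $\gamma_t$ on $[0,t]$ and $\gamma_t(t)$ on $(t,s]$; $\gamma_{t,s,A}\in\hat\Lambda_s$ equals $\gamma_t$ on $[0,t]$ and $e^{(\sigma-t)A}\gamma_t(t)$ at $\sigma\in(t,s]$. Put $\|\gamma_t\|_0=\sup_{0\le s\le t}|\gamma_t(s)|$, $d_\infty(\gamma_t,\eta_s)=|t-s|+\|\gamma_{t,T,A}-\eta_{s,T,A}\|_0$. For $f:\hat\Lambda\to\mathbb R$ and $\gamma_s\in\hat\Lambda_s$: $\partial_tf(\gamma_s)=\lim_{h\downarrow0}\frac1h[f(\gamma_{s,s+h})-f(\gamma_s)]$ for $s<T$, and $\partial_tf(\gamma_T)=\lim_{s\uparrow T}\partial_tf(\gamma_T|_{[0,s]})$; $\partial_xf(\gamma_s)\in H$ and $\partial_{xx}f(\gamma_s)\in\mathcal S(H)$ are the first and second Fréchet derivatives at $h=0$ of $h\mapsto f(\gamma_s^h)$, $h\in H$. $f\in C^{1,2}_p(\hat\Lambda)$ means $f,\partial_tf,\partial_xf,\partial_{xx}f$ exist on $\hat\Lambda$, are continuous under $d_\infty$ and have polynomial growth in $\|\gamma_s\|_0$. *)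

theory Defs
  imports "HOL-Analysis.Analysis"
begin

section \<open>Strongly continuous semigroups and their generators\<close>

definition C0_semigroup :: "(real \<Rightarrow> 'h::real_normed_vector \<Rightarrow>\<^sub>L 'h) \<Rightarrow> bool" where
  "C0_semigroup E \<longleftrightarrow>
     E 0 = id_blinfun \<and>
     (\<forall>s\<ge>0. \<forall>r\<ge>0. E (s + r) = E s o\<^sub>L E r) \<and>
     (\<forall>x. continuous_on {0..} (\<lambda>s. blinfun_apply (E s) x))"

text \<open>\<open>A\<close> is an (in general unbounded) operator with domain \<open>D\<close>; its values outside \<open>D\<close> are
  irrelevant. \<open>E s\<close> plays the role of the operator exponential of \<open>s A\<close>; only \<open>s \<ge> 0\<close> matters.\<close>

definition generates_C0_semigroup ::
  "'h set \<Rightarrow> ('h \<Rightarrow> 'h) \<Rightarrow> (real \<Rightarrow> 'h::real_normed_vector \<Rightarrow>\<^sub>L 'h) \<Rightarrow> bool" where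
  "generates_C0_semigroup D A E \<longleftrightarrow>
     C0_semigroup E \<and>
     D = {x. \<exists>y. ((\<lambda>h. (blinfun_apply (E h) x - x) /\<^sub>R h) \<longlongrightarrow> y) (at_right 0)} \<and>
     (\<forall>x\<in>D. ((\<lambda>h. (blinfun_apply (E h) x - x) /\<^sub>R h) \<longlongrightarrow> A x) (at_right 0))"


section \<open>Cadlag paths\<close>

text \<open>A path on \<open>[0,t]\<close> is a pair \<open>(t, \<gamma>)\<close>. Requiring \<open>\<gamma>\<close> to be extensional on \<open>{0..t}\<close> makes
  the pair carry no information beyond the values on \<open>[0,t]\<close>.\<close>

type_synonym 'h path = "real \<times> (real \<Rightarrow> 'h)"

definition cadlag_upto :: "real \<Rightarrow> (real \<Rightarrow> 'h::topological_space) \<Rightarrow> bool" where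
  "cadlag_upto t \<gamma> \<longleftrightarrow>
     (\<forall>s\<in>{0..<t}. (\<gamma> \<longlongrightarrow> \<gamma> s) (at_right s)) \<and>
     (\<forall>s\<in>{0<..t}. \<exists>l. (\<gamma> \<longlongrightarrow> l) (at_left s))"

definition Lambda_at :: "real \<Rightarrow> 'h::topological_space path set" where
  "Lambda_at t = {(t, \<gamma>) | \<gamma>. \<gamma> \<in> extensional {0..t} \<and> cadlag_upto t \<gamma>}"

definition Lambda_hat :: "real \<Rightarrow> 'h::topological_space path set" where
  "Lambda_hat T = (\<Union>t\<in>{0..T}. Lambda_at t)"

definition endpoint :: "'h path \<Rightarrow> 'h" where
  "endpoint p = snd p (fst p)"

definition bump :: "'h::plus path \<Rightarrow> 'h \<Rightarrow> 'h path" where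
  "bump p x = (fst p, (snd p)(fst p := endpoint p + x))"

definition restrict_path :: "'h path \<Rightarrow> real \<Rightarrow> 'h path" where
  "restrict_path p s = (s, restrict (snd p) {0..s})"

definition flat_ext :: "'h path \<Rightarrow> real \<Rightarrow> 'h path" where
  "flat_ext p s = (s, \<lambda>\<sigma>\<in>{0..s}. if \<sigma> \<le> fst p then snd p \<sigma> else endpoint p)"

definition semigroup_ext ::
  "(real \<Rightarrow> 'h::real_normed_vector \<Rightarrow>\<^sub>L 'h) \<Rightarrow> 'h path \<Rightarrow> real \<Rightarrow> 'h path" where
  "semigroup_ext E p s =
     (s, \<lambda>\<sigma>\<in>{0..s}. if \<sigma> \<le> fst p then snd p \<sigma> else blinfun_apply (E (\<sigma> - fst p)) (endpoint p))"

definition norm0 :: "'h::real_normed_vector path \<Rightarrow> real" where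
  "norm0 p = (SUP s\<in>{0..fst p}. norm (snd p s))"

definition d_inf ::
  "real \<Rightarrow> (real \<Rightarrow> 'h::real_normed_vector \<Rightarrow>\<^sub>L 'h) \<Rightarrow> 'h path \<Rightarrow> 'h path \<Rightarrow> real" where
  "d_inf T E p q =
     \<bar>fst p - fst q\<bar> +
     norm0 (T, \<lambda>\<sigma>\<in>{0..T}. snd (semigroup_ext E p T) \<sigma> - snd (semigroup_ext E q T) \<sigma>)"


section \<open>Path derivatives and smooth functionals\<close>

text \<open>The first conjunct only involves \<open>h\<close> with \<open>s + h \<le> T\<close>, the second only \<open>s \<in> (0,T)\<close>,
  because the limits are one-sided.\<close>

definition has_path_time_derivative ::
  "real \<Rightarrow> ('h::topological_space path \<Rightarrow> real) \<Rightarrow> ('h path \<Rightarrow> real) \<Rightarrow> bool" where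
  "has_path_time_derivative T f f' \<longleftrightarrow>
     (\<forall>p\<in>Lambda_hat T. fst p < T \<longrightarrow>
        ((\<lambda>h. (f (flat_ext p (fst p + h)) - f p) / h) \<longlongrightarrow> f' p) (at_right 0)) \<and>
     (\<forall>p\<in>Lambda_at T. ((\<lambda>s. f' (restrict_path p s)) \<longlongrightarrow> f' p) (at_left T))"

definition self_adjoint :: "('h::real_inner \<Rightarrow>\<^sub>L 'h) \<Rightarrow> bool" where
  "self_adjoint Q \<longleftrightarrow> (\<forall>x y. blinfun_apply Q x \<bullet> y = x \<bullet> blinfun_apply Q y)"

text \<open>Second Frechet derivative of a real function at \<open>x\<close>, with the dual of the Hilbert space
  identified with the space itself: the Frechet derivative of the gradient.\<close>

definition has_second_derivative_at ::
  "('h::real_inner \<Rightarrow> real) \<Rightarrow> ('h \<Rightarrow>\<^sub>L 'h) \<Rightarrow> 'h \<Rightarrow> bool" where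
  "has_second_derivative_at F Q x \<longleftrightarrow>
     (\<exists>G. (\<forall>\<^sub>F y in nhds x. GDERIV F y :> G y) \<and> (G has_derivative blinfun_apply Q) (at x))"

definition has_path_space_derivative ::
  "real \<Rightarrow> ('h::real_inner path \<Rightarrow> real) \<Rightarrow> ('h path \<Rightarrow> 'h) \<Rightarrow> bool" where
  "has_path_space_derivative T f f' \<longleftrightarrow>
     (\<forall>p\<in>Lambda_hat T. GDERIV (\<lambda>h. f (bump p h)) 0 :> f' p)"

definition has_path_second_space_derivative ::
  "real \<Rightarrow> ('h::real_inner path \<Rightarrow> real) \<Rightarrow> ('h path \<Rightarrow> 'h \<Rightarrow>\<^sub>L 'h) \<Rightarrow> bool" where
  "has_path_second_space_derivative T f f'' \<longleftrightarrow>
     (\<forall>p\<in>Lambda_hat T.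
        self_adjoint (f'' p) \<and> has_second_derivative_at (\<lambda>h. f (bump p h)) (f'' p) 0)"

definition d_inf_continuous ::
  "real \<Rightarrow> (real \<Rightarrow> 'h::real_normed_vector \<Rightarrow>\<^sub>L 'h) \<Rightarrow> ('h path \<Rightarrow> 'b::metric_space) \<Rightarrow> bool" where
  "d_inf_continuous T E f \<longleftrightarrow>
     (\<forall>p\<in>Lambda_hat T. \<forall>\<epsilon>>0. \<exists>\<delta>>0. \<forall>q\<in>Lambda_hat T.
        d_inf T E p q < \<delta> \<longrightarrow> dist (f p) (f q) < \<epsilon>)"

definition polynomial_growth ::
  "real \<Rightarrow> ('h::real_normed_vector path \<Rightarrow> 'b::real_normed_vector) \<Rightarrow> bool" where
  "polynomial_growth T f \<longleftrightarrow>
     (\<exists>(L::real) (k::nat). \<forall>p\<in>Lambda_hat T. norm (f p) \<le> L * (1 + norm0 p ^ k))"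

definition C12p ::
  "real \<Rightarrow> (real \<Rightarrow> 'h::real_inner \<Rightarrow>\<^sub>L 'h) \<Rightarrow> ('h path \<Rightarrow> real) set" where
  "C12p T E = {f. \<exists>ft fx fxx.
     has_path_time_derivative T f ft \<and>
     has_path_space_derivative T f fx \<and>
     has_path_second_space_derivative T f fxx \<and>
     d_inf_continuous T E f \<and> d_inf_continuous T E ft \<and>
     d_inf_continuous T E fx \<and> d_inf_continuous T E fxx \<and>
     polynomial_growth T f \<and> polynomial_growth T ft \<and>
     polynomial_growth T fx \<and> polynomial_growth T fxx}"


section \<open>The functionals\<close>

definition S_fun :: "'h::real_normed_vector path \<Rightarrow> real" where
  "S_fun p = (if norm0 p \<noteq> 0
     then (norm0 p ^ 6 - norm (endpoint p) ^ 6) ^ 3 / norm0 p ^ 12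
     else 0)"

definition Upsilon :: "real \<Rightarrow> 'h::real_normed_vector path \<Rightarrow> real" where
  "Upsilon M p = S_fun p + M * norm (endpoint p) ^ 6"

end

theory Submission
  imports Defs
begin

text \<open>Shifting the endpoint of a path leaves \<open>m\<close>, the supremum of the norm before the endpoint,
  unchanged, and \<open>S\<close> is then \<open>max (m ^ 6 - norm y ^ 6) 0 ^ 3 / m ^ 12\<close> as a function of the
  endpoint \<open>y\<close>; this is twice differentiable because the cube of the positive part is. The
  functional \<open>m\<close> is not continuous under \<open>d_inf\<close>, but the derivatives vanish wherever
  \<open>m\<close> and \<open>norm0\<close> differ, so that \<open>m\<close> can be replaced by \<open>norm0\<close>. Both
  \<open>norm0\<close> and \<open>endpoint\<close> are continuous under \<open>d_inf\<close>, by the local uniform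
  boundedness of the semigroup. A flat extension changes neither, so the time derivative is \<open>0\<close>.\<close>

section \<open>Local uniform boundedness of the semigroup\<close>

text \<open>Banach-Steinhaus via Baire: the closed sets \<open>C n\<close> cover the complete space,
  so one of them contains a ball, and differences carry the bound on this ball over to vectors near
  \<open>0\<close>.\<close>

lemma uniform_boundedness:
  fixes F :: "('a::banach \<Rightarrow>\<^sub>L 'b::real_normed_vector) set"
  assumes ptw: "\<And>x. \<exists>c. \<forall>f\<in>F. norm (blinfun_apply f x) \<le> c"
  shows "\<exists>K. \<forall>f\<in>F. norm f \<le> K"
proof -
  define C where "C n = {x. \<forall>f\<in>F. norm (blinfun_apply f x) \<le> real n}" for n :: nat
  have "C n = (\<Inter>f\<in>F. {x. norm (blinfun_apply f x) \<le> real n})" for n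
    by (auto simp: C_def)
  then have cl: "closed (C n)" for n
    by (auto intro!: closed_INT closed_Collect_le continuous_intros)
  have cover: "(\<Union>n. C n) = UNIV"
  proof -
    have "x \<in> (\<Union>n. C n)" for x
    proof -
      obtain c where "\<forall>f\<in>F. norm (blinfun_apply f x) \<le> c" using ptw by blast
      moreover obtain n where "c \<le> real n" using real_arch_simple by blast
      ultimately have "x \<in> C n" by (auto simp: C_def intro: order_trans)
      then show ?thesis by blast
    qed
    then show ?thesis by blast
  qed
  have "\<exists>n. interior (C n) \<noteq> {}"
  proof (rule ccontr)
    assume "\<not> ?thesis"
    then have "euclidean interior_of \<Union>(range C) = {}"
      by (intro Baire_category_alt) (use cl completely_metrizable_space_euclidean in auto)
    then show False by (simp add: cover)
  qed
  then obtain n x0 where "x0 \<in> interior (C n)" by blast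
  then obtain e where e: "e > 0" "ball x0 e \<subseteq> C n" by (meson mem_interior)
  have "norm f \<le> 4 * real n / e" if f: "f \<in> F" for f
  proof (rule norm_blinfun_bound)
    show "norm (blinfun_apply f x) \<le> 4 * real n / e * norm x" for x
    proof (cases "x = 0")
      case False
      \<comment> \<open>Length \<open>e / 2\<close> keeps \<open>x0 + z\<close> inside the ball; the
        bound \<open>2 * n\<close> for \<open>f\<close> at \<open>z\<close> then gives the constant
        \<open>4 * n / e\<close>.\<close>
      define z where "z = (e / (2 * norm x)) *\<^sub>R x"
      have nz: "norm z = e / 2" using False e by (simp add: z_def)
      have "x0 \<in> C n" "x0 + z \<in> C n" using e nz by (auto simp: subset_iff dist_norm)
      then have "norm (blinfun_apply f x0) \<le> n" "norm (blinfun_apply f (x0 + z)) \<le> n"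
        using f by (auto simp: C_def)
      moreover have "blinfun_apply f z = blinfun_apply f (x0 + z) - blinfun_apply f x0"
        by (simp add: blinfun.add_right)
      ultimately have "norm (blinfun_apply f z) \<le> 2 * n"
        using norm_triangle_ineq4[of "blinfun_apply f (x0 + z)" "blinfun_apply f x0"] by simp
      moreover have "norm (blinfun_apply f z) = e / (2 * norm x) * norm (blinfun_apply f x)"
        using e by (simp add: z_def blinfun.scaleR_right)
      ultimately show ?thesis using e False by (simp add: field_simps)
    qed simp
  qed (use e in simp)
  then show ?thesis by blast
qed

text \<open>Orbits are continuous, hence bounded on the compact interval, and uniform boundedness
  applies. With \<open>K \<ge> 1\<close> the same constant also serves where a path is not yet moved
  by the semigroup.\<close>

lemma C0_semigroup_bounded:
  fixes E :: "real \<Rightarrow> 'h::banach \<Rightarrow>\<^sub>L 'h"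
  assumes "C0_semigroup E"
  shows "\<exists>K\<ge>1. \<forall>r\<in>{0..T}. norm (E r) \<le> K"
proof -
  have "\<exists>c. \<forall>f\<in>E ` {0..T}. norm (blinfun_apply f x) \<le> c" for x
  proof -
    have "continuous_on {0..T} (\<lambda>s. blinfun_apply (E s) x)"
      using assms unfolding C0_semigroup_def by (meson atLeastAtMost_iff atLeast_iff continuous_on_subset subsetI)
    then have "bounded ((\<lambda>s. blinfun_apply (E s) x) ` {0..T})"
      by (simp add: compact_continuous_image compact_imp_bounded)
    then show ?thesis by (auto simp: bounded_iff)
  qed
  then obtain K where "\<forall>f\<in>E ` {0..T}. norm f \<le> K" using uniform_boundedness by meson
  then show ?thesis by (intro exI[of _ "max 1 K"]) auto
qed

lemma C0_semigroup_small:
  assumes "C0_semigroup E" "\<epsilon> > 0"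
  shows "\<exists>\<delta>>0. \<forall>r. 0 \<le> r \<and> r < \<delta> \<longrightarrow> norm (blinfun_apply (E r) x - x) < \<epsilon>"
proof -
  have c: "continuous_on {0..} (\<lambda>s. blinfun_apply (E s) x)" and 0: "E 0 = id_blinfun"
    using assms by (auto simp: C0_semigroup_def)
  then obtain \<delta> where "\<delta> > 0"
      "\<forall>r\<in>{0..}. dist r 0 < \<delta> \<longrightarrow> dist (blinfun_apply (E r) x) (blinfun_apply (E 0) x) < \<epsilon>"
    using assms(2) by (force simp: continuous_on_iff)
  then show ?thesis using 0 by (auto simp: dist_norm)
qed

section \<open>Continuity with respect to the path metric\<close>

lemma Lambda_hatD:
  assumes "p \<in> Lambda_hat T"
  shows "0 \<le> fst p" "fst p \<le> T" "cadlag_upto (fst p) (snd p)"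
  using assms by (auto simp: Lambda_hat_def Lambda_at_def)

text \<open>One-sided limits bound the path in a punctured neighbourhood of each point; adding the
  value at the point and passing to a finite subcover gives a global bound.\<close>

lemma cadlag_upto_bounded:
  fixes \<gamma> :: "real \<Rightarrow> 'h::real_normed_vector"
  assumes "cadlag_upto t \<gamma>"
  shows "bounded (\<gamma> ` {0..t})"
proof -
  have loc: "\<exists>U. open U \<and> s \<in> U \<and> bounded (\<gamma> ` (U \<inter> {0..t}))" if s: "s \<in> {0..t}" for s
  proof -
    have tendsto_bdd: "\<exists>c. \<forall>\<^sub>F r in G. norm (\<gamma> r) \<le> c" if "(\<gamma> \<longlongrightarrow> l) G" for l G
    proof -
      have "\<forall>\<^sub>F r in G. dist (\<gamma> r) l < 1" using tendstoD[OF that, of 1] by simp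
      then have "\<forall>\<^sub>F r in G. norm (\<gamma> r) \<le> norm l + 1"
        by eventually_elim (smt (verit) dist_norm norm_triangle_sub)
      then show ?thesis by blast
    qed
    obtain c1 where "\<forall>\<^sub>F r in at_right s. r \<in> {0..t} \<longrightarrow> norm (\<gamma> r) \<le> c1"
    proof (cases "s < t")
      case True
      then have "(\<gamma> \<longlongrightarrow> \<gamma> s) (at_right s)" using assms s by (auto simp: cadlag_upto_def)
      from tendsto_bdd[OF this] obtain c where "\<forall>\<^sub>F r in at_right s. norm (\<gamma> r) \<le> c" ..
      then show thesis by (intro that[of c]) (auto elim: eventually_mono)
    next
      case False
      \<comment> \<open>At \<open>s = t\<close> no right limit is assumed, but no point of
        \<open>{0..t}\<close> lies to the right, so the bound \<open>0\<close> holds vacuously. The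
        left side at \<open>s = 0\<close> is analogous.\<close>
      have "\<forall>\<^sub>F r in at_right s. r > s" by (simp add: eventually_at_filter)
      then show thesis using False by (intro that[of 0]) (auto elim: eventually_mono)
    qed
    moreover obtain c2 where "\<forall>\<^sub>F r in at_left s. r \<in> {0..t} \<longrightarrow> norm (\<gamma> r) \<le> c2"
    proof (cases "0 < s")
      case True
      then obtain l where "(\<gamma> \<longlongrightarrow> l) (at_left s)"
        using assms s unfolding cadlag_upto_def by (meson atLeastAtMost_iff greaterThanAtMost_iff)
      from tendsto_bdd[OF this] obtain c where "\<forall>\<^sub>F r in at_left s. norm (\<gamma> r) \<le> c" ..
      then show thesis by (intro that[of c]) (auto elim: eventually_mono)
    next
      case False
      have "\<forall>\<^sub>F r in at_left s. r < s" by (simp add: eventually_at_filter)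
      then show thesis using False by (intro that[of 0]) (auto elim: eventually_mono)
    qed
    ultimately have "\<forall>\<^sub>F r in at s. r \<in> {0..t} \<longrightarrow> norm (\<gamma> r) \<le> max c1 c2"
      unfolding eventually_at_split by (auto elim!: eventually_mono)
    then obtain U where U: "open U" "s \<in> U"
        "\<forall>r\<in>U. r \<noteq> s \<longrightarrow> r \<in> {0..t} \<longrightarrow> norm (\<gamma> r) \<le> max c1 c2"
      unfolding eventually_at_topological by auto
    have "norm (\<gamma> r) \<le> max (max c1 c2) (norm (\<gamma> s))" if "r \<in> U \<inter> {0..t}" for r
      using U(3) that by (cases "r = s") (auto simp: le_max_iff_disj)
    then have "bounded (\<gamma> ` (U \<inter> {0..t}))" unfolding bounded_iff by blast
    then show ?thesis using U by blast
  qed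
  then obtain U where U: "\<And>s. s \<in> {0..t} \<Longrightarrow> open (U s) \<and> s \<in> U s \<and> bounded (\<gamma> ` (U s \<inter> {0..t}))"
    by metis
  obtain X where X: "X \<subseteq> {0..t}" "finite X" "{0..t} \<subseteq> (\<Union>s\<in>X. U s)"
    using compactE_image[OF compact_Icc, of "{0..t}" U 0 t] U by blast
  have "bounded (\<Union>s\<in>X. \<gamma> ` (U s \<inter> {0..t}))"
    using X(2) by (rule bounded_UN) (use X(1) U in blast)
  then show ?thesis by (rule bounded_subset) (use X in blast)
qed

lemma bdd_above_norm_path:
  fixes p :: "'h::real_normed_vector path"
  assumes "p \<in> Lambda_hat T"
  shows "bdd_above ((\<lambda>s. norm (snd p s)) ` {0..fst p})"
  using cadlag_upto_bounded[OF Lambda_hatD(3)[OF assms]]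
  by (auto simp: bounded_iff bdd_above_def)

lemma norm_le_norm0:
  assumes "p \<in> Lambda_hat T" "0 \<le> s" "s \<le> fst p"
  shows "norm (snd p s) \<le> norm0 p"
  unfolding norm0_def using assms by (intro cSUP_upper bdd_above_norm_path) auto

lemma norm0_le:
  assumes "p \<in> Lambda_hat T" "\<And>s. 0 \<le> s \<Longrightarrow> s \<le> fst p \<Longrightarrow> norm (snd p s) \<le> c"
  shows "norm0 p \<le> c"
  unfolding norm0_def using assms Lambda_hatD(1)[OF assms(1)] by (intro cSUP_least) auto

lemma norm_endpoint_le_norm0:
  "p \<in> Lambda_hat T \<Longrightarrow> norm (endpoint p) \<le> norm0 p"
  using norm_le_norm0[of p T "fst p"] Lambda_hatD(1)[of p T] by (simp add: endpoint_def)

lemma norm0_nonneg: "p \<in> Lambda_hat T \<Longrightarrow> 0 \<le> norm0 p"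
  using norm_endpoint_le_norm0 norm_ge_zero order_trans by blast

text \<open>The values of \<open>semigroup_ext\<close> without horizon and restriction; both agree
  on \<open>{0..T}\<close>.\<close>

definition ext_val :: "(real \<Rightarrow> 'h::real_normed_vector \<Rightarrow>\<^sub>L 'h) \<Rightarrow> 'h path \<Rightarrow> real \<Rightarrow> 'h" where
  "ext_val E p \<sigma> =
     (if \<sigma> \<le> fst p then snd p \<sigma> else blinfun_apply (E (\<sigma> - fst p)) (endpoint p))"

text \<open>A real \<open>SUP\<close> dominates its members only over a set bounded above. Cadlag
  paths are bounded and so is the semigroup on \<open>{0..T}\<close>, hence the supremum in
  \<open>d_inf\<close> controls every pointwise difference.\<close>

lemma d_inf_ext_val:
  fixes E :: "real \<Rightarrow> 'h::banach \<Rightarrow>\<^sub>L 'h"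
  assumes E: "C0_semigroup E" and p: "p \<in> Lambda_hat T" and q: "q \<in> Lambda_hat T"
    and d: "d_inf T E p q < \<delta>"
  shows "\<bar>fst p - fst q\<bar> < \<delta>"
    and "\<And>\<sigma>. 0 \<le> \<sigma> \<Longrightarrow> \<sigma> \<le> T \<Longrightarrow> norm (ext_val E p \<sigma> - ext_val E q \<sigma>) < \<delta>"
proof -
  obtain K where K: "K \<ge> 1" "\<And>r. 0 \<le> r \<Longrightarrow> r \<le> T \<Longrightarrow> norm (E r) \<le> K"
    using C0_semigroup_bounded[OF E] by (metis atLeastAtMost_iff)
  have bnd: "norm (ext_val E a \<sigma>) \<le> K * norm0 a"
    if a: "a \<in> Lambda_hat T" and \<sigma>: "0 \<le> \<sigma>" "\<sigma> \<le> T" for a \<sigma>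
  proof (cases "\<sigma> \<le> fst a")
    case True
    then have "norm (ext_val E a \<sigma>) \<le> 1 * norm0 a"
      using norm_le_norm0[OF a] \<sigma> by (simp add: ext_val_def)
    also have "\<dots> \<le> K * norm0 a" using K norm0_nonneg[OF a] by (intro mult_right_mono) auto
    finally show ?thesis .
  next
    case False
    have "norm (ext_val E a \<sigma>) \<le> norm (E (\<sigma> - fst a)) * norm (endpoint a)"
      using False by (simp add: ext_val_def norm_blinfun)
    also have "\<dots> \<le> K * norm0 a"
      using K False \<sigma> Lambda_hatD[OF a] norm_endpoint_le_norm0[OF a] by (intro mult_mono) auto
    finally show ?thesis .
  qed
  have T: "0 \<le> T" using Lambda_hatD[OF p] by simp
  define N where "N = (SUP \<sigma>\<in>{0..T}. norm (ext_val E p \<sigma> - ext_val E q \<sigma>))"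
  have deq: "d_inf T E p q = \<bar>fst p - fst q\<bar> + N"
    unfolding d_inf_def norm0_def N_def by (auto simp: semigroup_ext_def ext_val_def intro!: SUP_cong)
  have bdd: "bdd_above ((\<lambda>\<sigma>. norm (ext_val E p \<sigma> - ext_val E q \<sigma>)) ` {0..T})"
    unfolding bdd_above_def
  proof (intro exI ballI, elim imageE)
    fix x \<sigma> assume x: "x = norm (ext_val E p \<sigma> - ext_val E q \<sigma>)" "\<sigma> \<in> {0..T}"
    then show "x \<le> K * norm0 p + K * norm0 q"
      using norm_triangle_ineq4[of "ext_val E p \<sigma>" "ext_val E q \<sigma>"] bnd[OF p, of \<sigma>] bnd[OF q, of \<sigma>] by auto
  qed
  have N: "norm (ext_val E p \<sigma> - ext_val E q \<sigma>) \<le> N" if "0 \<le> \<sigma>" "\<sigma> \<le> T" for \<sigma>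
    unfolding N_def using bdd that by (intro cSUP_upper) auto
  have "0 \<le> N" using N[of 0] T norm_ge_zero order_trans by blast
  then show "\<bar>fst p - fst q\<bar> < \<delta>" using d deq by simp
  show "norm (ext_val E p \<sigma> - ext_val E q \<sigma>) < \<delta>" if "0 \<le> \<sigma>" "\<sigma> \<le> T" for \<sigma>
    using N[OF that] d deq by simp
qed

text \<open>The delicate case is a path \<open>q\<close> stopping at \<open>s\<close> before the endpoint \<open>t\<close> of \<open>p\<close>: then
  \<open>q(s)\<close> is close to \<open>p(s)\<close>, hence to the left limit of \<open>p\<close> at \<open>t\<close>, which the semigroup
  moves little. So \<open>q(s)\<close> is close to the value at \<open>t\<close> of the extension of \<open>q\<close>, and therefore to
  \<open>p(t)\<close>; a jump of \<open>p\<close> at \<open>t\<close> excludes this case altogether.\<close>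

lemma d_inf_near:
  fixes E :: "real \<Rightarrow> 'h::banach \<Rightarrow>\<^sub>L 'h"
  assumes E: "C0_semigroup E" and p: "p \<in> Lambda_hat T" and \<epsilon>: "\<epsilon> > 0"
  shows "\<exists>\<delta>>0. \<forall>q\<in>Lambda_hat T. d_inf T E p q < \<delta> \<longrightarrow>
    \<bar>norm0 p - norm0 q\<bar> < \<epsilon> \<and> norm (endpoint p - endpoint q) < \<epsilon>"
proof -
  obtain K where K: "K \<ge> 1" "\<And>r. 0 \<le> r \<Longrightarrow> r \<le> T \<Longrightarrow> norm (E r) \<le> K"
    using C0_semigroup_bounded[OF E] by (metis atLeastAtMost_iff)
  define t where "t = fst p"
  \<comment> \<open>The worst estimate below is \<open>2 * (K * \<eta>) + 4 * \<eta>\<close>; the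
    denominator \<open>2 * K + 5\<close> leaves room for strict inequality.\<close>
  define \<eta> where "\<eta> = \<epsilon> / (2 * K + 5)"
  have \<eta>: "\<eta> > 0" and \<eta>\<epsilon>: "(2 * K + 5) * \<eta> = \<epsilon>" using \<epsilon> K by (auto simp: \<eta>_def field_simps)
  have "0 \<le> K * \<eta>" using K \<eta> by simp
  then have \<eta>2: "2 * \<eta> < \<epsilon>" "2 * (K * \<eta>) + 4 * \<eta> < \<epsilon>" using \<eta>\<epsilon> \<eta> by (auto simp: algebra_simps)
  have tT: "0 \<le> t" "t \<le> T" and cad: "cadlag_upto t (snd p)"
    using Lambda_hatD[OF p] by (auto simp: t_def)
  obtain \<delta>1 where \<delta>1: "\<delta>1 > 0" "\<And>r. 0 \<le> r \<Longrightarrow> r < \<delta>1 \<Longrightarrow> norm (blinfun_apply (E r) (endpoint p) - endpoint p) < \<eta>"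
    using C0_semigroup_small[OF E \<eta>] by meson
  \<comment> \<open>\<open>l\<close> is the left limit of \<open>p\<close> at \<open>t\<close>. For
    \<open>t = 0\<close> the condition on \<open>s\<close> is void, so any \<open>l\<close>
    serves.\<close>
  obtain l \<delta>2 where \<delta>2: "\<delta>2 > 0" "\<And>s. 0 \<le> s \<Longrightarrow> s < t \<Longrightarrow> t - s < \<delta>2 \<Longrightarrow> norm (snd p s - l) < \<eta>"
  proof (cases "0 < t")
    case True
    then obtain l where "(snd p \<longlongrightarrow> l) (at_left t)"
      using cad unfolding cadlag_upto_def by (meson greaterThanAtMost_iff order_refl)
    then have "\<forall>\<^sub>F s in at_left t. dist (snd p s) l < \<eta>" using \<eta> by (rule tendstoD)
    then obtain d where "d > 0" "\<forall>s\<in>{..<t}. s \<noteq> t \<and> dist s t < d \<longrightarrow> dist (snd p s) l < \<eta>"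
      unfolding eventually_at by blast
    then show thesis by (intro that[of d l]) (auto simp: dist_norm)
  qed (use that[of 1] in auto)
  obtain \<delta>3 where \<delta>3: "\<delta>3 > 0" "\<And>r. 0 \<le> r \<Longrightarrow> r < \<delta>3 \<Longrightarrow> norm (blinfun_apply (E r) l - l) < \<eta>"
    using C0_semigroup_small[OF E \<eta>] by meson
  define \<delta> where "\<delta> = min (min \<delta>1 \<delta>2) (min \<delta>3 \<eta>)"
  have \<delta>: "\<delta> > 0" "\<delta> \<le> \<delta>1" "\<delta> \<le> \<delta>2" "\<delta> \<le> \<delta>3" "\<delta> \<le> \<eta>" using \<delta>1 \<delta>2 \<delta>3 \<eta> by (auto simp: \<delta>_def)
  show ?thesis
  proof (intro exI conjI ballI impI)
    show "\<delta> > 0" by fact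
    fix q assume q: "q \<in> Lambda_hat T" and d: "d_inf T E p q < \<delta>"
    define s where "s = fst q"
    have sT: "0 \<le> s" "s \<le> T" using Lambda_hatD[OF q] by (auto simp: s_def)
    have ts: "\<bar>t - s\<bar> < \<delta>" using d_inf_ext_val(1)[OF E p q d] by (simp add: t_def s_def)
    have near: "norm (ext_val E p \<sigma> - ext_val E q \<sigma>) < \<eta>" if "0 \<le> \<sigma>" "\<sigma> \<le> T" for \<sigma>
      using d_inf_ext_val(2)[OF E p q d that] \<delta> by simp
    have near': "norm (snd p \<sigma> - snd q \<sigma>) < \<eta>" if "0 \<le> \<sigma>" "\<sigma> \<le> t" "\<sigma> \<le> s" for \<sigma>
      using near[of \<sigma>] that tT by (simp add: ext_val_def t_def s_def)
    have np: "norm (snd p \<sigma>) \<le> norm0 p" if "0 \<le> \<sigma>" "\<sigma> \<le> t" for \<sigma>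
      using norm_le_norm0[OF p] that by (simp add: t_def)
    have nq: "norm (snd q \<sigma>) \<le> norm0 q" if "0 \<le> \<sigma>" "\<sigma> \<le> s" for \<sigma>
      using norm_le_norm0[OF q] that by (simp add: s_def)
    have ep: "endpoint p = snd p t" and eq: "endpoint q = snd q s"
      by (auto simp: endpoint_def t_def s_def)
    have "\<bar>norm0 p - norm0 q\<bar> < \<epsilon> \<and> norm (endpoint p - endpoint q) < \<epsilon>"
    proof (cases "t \<le> s")
      case True
      \<comment> \<open>Past \<open>t\<close>, the path \<open>q\<close> is within
        \<open>\<eta>\<close> of the orbit of \<open>endpoint p\<close>, which itself has moved less
        than \<open>\<eta>\<close> by the choice of \<open>\<delta>1\<close>.\<close>
      have close: "norm (snd q \<sigma> - endpoint p) < 2 * \<eta>" if \<sigma>: "t \<le> \<sigma>" "\<sigma> \<le> s" for \<sigma>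
      proof (cases "\<sigma> = t")
        case True
        then show ?thesis using near'[of t] \<sigma> tT \<eta> by (simp add: ep norm_minus_commute)
      next
        case False
        then have "norm (blinfun_apply (E (\<sigma> - t)) (endpoint p) - snd q \<sigma>) < \<eta>"
          using near[of \<sigma>] \<sigma> tT sT by (auto simp: ext_val_def t_def s_def)
        moreover have "norm (blinfun_apply (E (\<sigma> - t)) (endpoint p) - endpoint p) < \<eta>"
          using \<sigma> ts \<delta> by (intro \<delta>1) auto
        ultimately show ?thesis by (smt (verit) norm_diff_triangle_less norm_minus_commute)
      qed
      have "norm0 q \<le> norm0 p + 2 * \<eta>"
      proof (rule norm0_le[OF q])
        fix \<sigma> assume \<sigma>: "0 \<le> \<sigma>" "\<sigma> \<le> fst q"
        show "norm (snd q \<sigma>) \<le> norm0 p + 2 * \<eta>"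
        proof (cases "\<sigma> \<le> t")
          case le: True
          then show ?thesis using near'[of \<sigma>] np[of \<sigma>] \<sigma> True \<eta>
              norm_triangle_sub[of "snd q \<sigma>" "snd p \<sigma>"] by (simp add: norm_minus_commute)
        next
          case False
          then show ?thesis using close[of \<sigma>] np[of t] \<sigma> tT
              norm_triangle_sub[of "snd q \<sigma>" "endpoint p"] by (simp add: s_def ep)
        qed
      qed
      moreover have "norm0 p \<le> norm0 q + \<eta>"
      proof (rule norm0_le[OF p])
        fix \<sigma> assume \<sigma>: "0 \<le> \<sigma>" "\<sigma> \<le> fst p"
        then show "norm (snd p \<sigma>) \<le> norm0 q + \<eta>"
          using near'[of \<sigma>] nq[of \<sigma>] True norm_triangle_sub[of "snd p \<sigma>" "snd q \<sigma>"] by (simp add: t_def)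
      qed
      ultimately show ?thesis
        using close[of s] True \<eta>2 \<eta> by (auto simp: eq norm_minus_commute)
    next
      case False
      then have st: "s < t" by simp
      have ql: "norm (snd q s - l) < 2 * \<eta>"
        using near'[of s] \<delta>2(2)[of s] sT st ts \<delta>
        by (smt (verit) norm_diff_triangle_less norm_minus_commute)
      \<comment> \<open>Strong continuity is not uniform in the vector, and
        \<open>endpoint q\<close> varies with \<open>q\<close>. It is therefore split at the fixed
        vector \<open>l\<close>: the motion of \<open>l\<close> costs \<open>\<eta>\<close>, and the
        deviation from \<open>l\<close> costs \<open>2 * (K * \<eta>)\<close> under the semigroup
        and \<open>2 * \<eta>\<close> without it.\<close>
      have stay: "norm (blinfun_apply (E r) (endpoint q) - endpoint q) < 2 * (K * \<eta>) + 3 * \<eta>"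
        if r: "0 \<le> r" "r \<le> t - s" for r
      proof -
        have "norm (blinfun_apply (E r) (snd q s - l)) \<le> norm (E r) * norm (snd q s - l)"
          by (rule norm_blinfun)
        also have "\<dots> \<le> K * (2 * \<eta>)" using K r tT sT ql by (intro mult_mono) auto
        finally have 1: "norm (blinfun_apply (E r) (snd q s - l)) \<le> 2 * (K * \<eta>)" by simp
        have 2: "norm (blinfun_apply (E r) l - l) < \<eta>" using r ts \<delta> by (intro \<delta>3) auto
        have "blinfun_apply (E r) (endpoint q) - endpoint q =
            blinfun_apply (E r) (snd q s - l) + (blinfun_apply (E r) l - l) - (snd q s - l)"
          by (simp add: eq blinfun.diff_right)
        also have "norm \<dots> < 2 * (K * \<eta>) + 3 * \<eta>"
          using 1 2 ql norm_triangle_ineq4[of "blinfun_apply (E r) (snd q s - l) + (blinfun_apply (E r) l - l)" "snd q s - l"]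
            norm_triangle_ineq[of "blinfun_apply (E r) (snd q s - l)" "blinfun_apply (E r) l - l"]
          by linarith
        finally show ?thesis .
      qed
      have close: "norm (snd p \<sigma> - endpoint q) < 2 * (K * \<eta>) + 4 * \<eta>" if \<sigma>: "s < \<sigma>" "\<sigma> \<le> t" for \<sigma>
      proof -
        have "norm (snd p \<sigma> - blinfun_apply (E (\<sigma> - s)) (endpoint q)) < \<eta>"
          using near[of \<sigma>] \<sigma> tT sT by (auto simp: ext_val_def t_def s_def)
        moreover have "norm (blinfun_apply (E (\<sigma> - s)) (endpoint q) - endpoint q) < 2 * (K * \<eta>) + 3 * \<eta>"
          using \<sigma> by (intro stay) auto
        ultimately show ?thesis by (smt (verit) norm_diff_triangle_less)
      qed
      have "norm0 q \<le> norm0 p + \<eta>"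
      proof (rule norm0_le[OF q])
        fix \<sigma> assume \<sigma>: "0 \<le> \<sigma>" "\<sigma> \<le> fst q"
        then show "norm (snd q \<sigma>) \<le> norm0 p + \<eta>"
          using near'[of \<sigma>] np[of \<sigma>] st norm_triangle_sub[of "snd q \<sigma>" "snd p \<sigma>"]
          by (simp add: s_def norm_minus_commute)
      qed
      moreover have "norm0 p \<le> norm0 q + (2 * (K * \<eta>) + 4 * \<eta>)"
      proof (rule norm0_le[OF p])
        fix \<sigma> assume \<sigma>: "0 \<le> \<sigma>" "\<sigma> \<le> fst p"
        show "norm (snd p \<sigma>) \<le> norm0 q + (2 * (K * \<eta>) + 4 * \<eta>)"
        proof (cases "\<sigma> \<le> s")
          case True
          then show ?thesis using near'[of \<sigma>] nq[of \<sigma>] \<sigma> st \<eta> \<open>0 \<le> K * \<eta>\<close>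
              norm_triangle_sub[of "snd p \<sigma>" "snd q \<sigma>"] by simp
        next
          case False
          then show ?thesis using close[of \<sigma>] nq[of s] \<sigma> sT
              norm_triangle_sub[of "snd p \<sigma>" "endpoint q"] by (simp add: t_def eq)
        qed
      qed
      ultimately show ?thesis using close[of t] st \<eta>2 \<eta> by (auto simp: ep)
    qed
    then show "\<bar>norm0 p - norm0 q\<bar> < \<epsilon>" "norm (endpoint p - endpoint q) < \<epsilon>" by auto
  qed
qed

text \<open>All pairs \<open>(norm0 p, endpoint p)\<close> lie in the cone, so continuity there
  suffices. This matters at the apex, where quotients by \<open>n ^ 12\<close> are controlled only
  inside the cone.\<close>

lemma d_inf_continuous_comp:
  fixes E :: "real \<Rightarrow> 'h::banach \<Rightarrow>\<^sub>L 'h" and g :: "real \<times> 'h \<Rightarrow> 'b::metric_space"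
  assumes E: "C0_semigroup E" and g: "continuous_on {z. norm (snd z) \<le> fst z} g"
  shows "d_inf_continuous T E (\<lambda>p. g (norm0 p, endpoint p))"
  unfolding d_inf_continuous_def
proof (intro ballI allI impI)
  fix p :: "'h path" and \<epsilon> :: real
  assume p: "p \<in> Lambda_hat T" and \<epsilon>: "\<epsilon> > 0"
  have mem: "(norm0 q, endpoint q) \<in> {z. norm (snd z) \<le> fst z}" if "q \<in> Lambda_hat T" for q :: "'h path"
    using norm_endpoint_le_norm0[OF that] by simp
  obtain d where d: "d > 0" "\<forall>z\<in>{z. norm (snd z) \<le> fst z}.
      dist z (norm0 p, endpoint p) < d \<longrightarrow> dist (g z) (g (norm0 p, endpoint p)) < \<epsilon>"
    using g mem[OF p] \<epsilon> unfolding continuous_on_iff by meson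
  then obtain \<delta> where \<delta>: "\<delta> > 0" "\<forall>q\<in>Lambda_hat T. d_inf T E p q < \<delta> \<longrightarrow>
      \<bar>norm0 p - norm0 q\<bar> < d / 2 \<and> norm (endpoint p - endpoint q) < d / 2"
    using d_inf_near[OF E p, of "d / 2"] by auto
  have "dist (g (norm0 p, endpoint p)) (g (norm0 q, endpoint q)) < \<epsilon>"
    if q: "q \<in> Lambda_hat T" "d_inf T E p q < \<delta>" for q
  proof -
    have "dist (norm0 q, endpoint q) (norm0 p, endpoint p) \<le> dist (norm0 q) (norm0 p) + dist (endpoint q) (endpoint p)"
      unfolding dist_Pair_Pair by (rule sqrt_sum_squares_le_sum) auto
    also have "\<dots> < d"
      using bspec[OF \<delta>(2) q(1)] q(2) by (simp add: dist_norm norm_minus_commute abs_minus_commute)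
    finally show ?thesis using d(2) mem[OF q(1)] by (metis dist_commute)
  qed
  then show "\<exists>\<delta>>0. \<forall>q\<in>Lambda_hat T. d_inf T E p q < \<delta> \<longrightarrow>
      dist (g (norm0 p, endpoint p)) (g (norm0 q, endpoint q)) < \<epsilon>"
    using \<delta> by blast
qed

section \<open>Space derivatives\<close>

text \<open>Away from \<open>0\<close> one branch of the maximum is locally constant in kind. At
  \<open>0\<close> the difference quotient is \<open>max h 0 ^ Suc k\<close>, and an exponent of at
  least two before division makes it tend to \<open>0\<close>.\<close>

lemma has_field_derivative_max_power:
  "((\<lambda>z::real. max z 0 ^ Suc (Suc k)) has_field_derivative (real (Suc (Suc k)) * max z 0 ^ Suc k)) (at z)"
proof -
  consider "z > 0" | "z < 0" | "z = 0" by linarith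
  then show ?thesis
  proof cases
    case 1
    have "((\<lambda>z::real. z ^ Suc (Suc k)) has_field_derivative (real (Suc (Suc k)) * max z 0 ^ Suc k)) (at z)"
      using DERIV_pow[of "Suc (Suc k)" z] 1 by (simp add: max_absorb1)
    then show ?thesis
      by (rule has_field_derivative_transform_within_open[where S="{0<..}"]) (use 1 in auto)
  next
    case 2
    have "((\<lambda>z::real. 0) has_field_derivative (real (Suc (Suc k)) * max z 0 ^ Suc k)) (at z)"
      using 2 by (auto intro!: derivative_eq_intros)
    then show ?thesis
      by (rule has_field_derivative_transform_within_open[where S="{..<0}"]) (use 2 in auto)
  next
    case 3
    have "((\<lambda>h::real. max h 0 ^ Suc k) \<longlongrightarrow> max 0 0 ^ Suc k) (at 0)"
      by (intro tendsto_intros)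
    then have "((\<lambda>h::real. max h 0 ^ Suc k) \<longlongrightarrow> 0) (at 0)" by simp
    moreover have "\<forall>\<^sub>F h::real in at 0. max h 0 ^ Suc k = max h 0 ^ Suc (Suc k) / h"
      by (auto simp: eventually_at_filter max_def)
    ultimately have "((\<lambda>h::real. max h 0 ^ Suc (Suc k) / h) \<longlongrightarrow> 0) (at 0)"
      by (rule Lim_transform_eventually)
    then show ?thesis using 3 by (simp add: DERIV_def)
  qed
qed

section \<open>Gradient and Hessian as functions of supremum norm and endpoint\<close>

text \<open>The rank-one operator \<open>y\<close> tensor \<open>y\<close>, composed of maps linear
  and bounded in \<open>y\<close>, so that continuity in operator norm follows by
  composition.\<close>

definition outer :: "'h::real_inner \<Rightarrow> 'h \<Rightarrow>\<^sub>L 'h" where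
  "outer y = blinfun_scaleR_left y o\<^sub>L blinfun_inner_right y"

lemma outer_apply [simp]: "blinfun_apply (outer y) v = (y \<bullet> v) *\<^sub>R y"
  by (simp add: outer_def)

lemma norm_outer_le: "norm (outer y) \<le> norm y ^ 2"
proof (rule norm_blinfun_bound)
  show "norm (blinfun_apply (outer y) v) \<le> norm y ^ 2 * norm v" for v
    using mult_right_mono[OF Cauchy_Schwarz_ineq2[of y v], of "norm y"]
    by (simp add: power2_eq_square mult_ac)
qed simp

lemma continuous_on_outer [continuous_intros]:
  "continuous_on S f \<Longrightarrow> continuous_on S (\<lambda>x. outer (f x))"
  unfolding outer_def
  by (intro bounded_bilinear.continuous_on[OF bounded_bilinear_blinfun_compose]
      bounded_linear.continuous_on[OF bounded_linear_blinfun_scaleR_left]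
      bounded_linear.continuous_on[OF bounded_linear_blinfun_inner_right])

text \<open>Gradient of \<open>S_val\<close> in \<open>y\<close> with \<open>n\<close> held fixed,
  to be evaluated at \<open>n = norm0 p\<close> although \<open>norm0\<close> may move with the
  endpoint.\<close>

definition S_grad :: "real \<times> 'h::real_inner \<Rightarrow> 'h" where
  "S_grad = (\<lambda>(n, y). (-18 * norm y ^ 4 * (n ^ 6 - norm y ^ 6) ^ 2 / n ^ 12) *\<^sub>R y)"

text \<open>Derivative of \<open>S_grad\<close> in \<open>y\<close> with \<open>n\<close> held
  fixed. The quotients by \<open>n ^ 12\<close> are bracketed in the form that
  \<open>max_power_diff\<close> rewrites.\<close>

definition S_hess :: "real \<times> 'h::real_inner \<Rightarrow> 'h \<Rightarrow>\<^sub>L 'h" where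
  "S_hess = (\<lambda>(n, y).
     (-18 * norm y ^ 4 * ((n ^ 6 - norm y ^ 6) ^ 2 / n ^ 12)) *\<^sub>R id_blinfun +
     (216 * norm y ^ 8 * ((n ^ 6 - norm y ^ 6) / n ^ 12) -
      72 * norm y ^ 2 * ((n ^ 6 - norm y ^ 6) ^ 2 / n ^ 12)) *\<^sub>R outer y)"

definition S_val :: "real \<times> 'h::real_inner \<Rightarrow> real" where
  "S_val = (\<lambda>(n, y). (n ^ 6 - norm y ^ 6) ^ 3 / n ^ 12)"

text \<open>Division by zero yields \<open>0\<close>, so the quotient already covers the case
  \<open>norm0 p = 0\<close>.\<close>

lemma S_fun_eq: "S_fun p = S_val (norm0 p, endpoint p)"
  by (simp add: S_fun_def S_val_def)

text \<open>For fixed \<open>m \<ge> 0\<close> (the supremum of the path before its endpoint), \<open>S\<close> depends on the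
  endpoint \<open>y\<close> through \<open>u = y \<bullet> y\<close> only; the positive part makes this twice
  differentiable across \<open>norm y = m\<close>. For \<open>m = 0\<close> all quotients are \<open>0\<close>.\<close>

definition profile :: "real \<Rightarrow> real \<Rightarrow> real" where
  "profile m u = max (m ^ 6 - u ^ 3) 0 ^ 3 / m ^ 12"

definition profile' :: "real \<Rightarrow> real \<Rightarrow> real" where
  "profile' m u = -9 * u ^ 2 * max (m ^ 6 - u ^ 3) 0 ^ 2 / m ^ 12"

definition profile'' :: "real \<Rightarrow> real \<Rightarrow> real" where
  "profile'' m u = (54 * u ^ 4 * max (m ^ 6 - u ^ 3) 0 - 18 * u * max (m ^ 6 - u ^ 3) 0 ^ 2) / m ^ 12"

lemma has_field_derivative_profile:
  "(profile m has_field_derivative profile' m u) (at u)"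
proof -
  have 1: "((\<lambda>u. m ^ 6 - u ^ 3) has_field_derivative - (3 * u ^ 2)) (at u)"
    by (auto intro!: derivative_eq_intros)
  have "((\<lambda>z::real. max z 0 ^ 3) has_field_derivative 3 * max (m ^ 6 - u ^ 3) 0 ^ 2) (at (m ^ 6 - u ^ 3))"
    using has_field_derivative_max_power[of 1] by (simp add: numeral_3_eq_3 numeral_2_eq_2)
  from DERIV_cdivide[OF DERIV_chain2[OF this 1], of "m ^ 12"] show ?thesis
    unfolding profile_def profile'_def by (simp add: mult_ac)
qed

lemma has_field_derivative_profile':
  "(profile' m has_field_derivative profile'' m u) (at u)"
proof -
  have 1: "((\<lambda>u. m ^ 6 - u ^ 3) has_field_derivative - (3 * u ^ 2)) (at u)"
    by (auto intro!: derivative_eq_intros)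
  have "((\<lambda>z::real. max z 0 ^ 2) has_field_derivative 2 * max (m ^ 6 - u ^ 3) 0) (at (m ^ 6 - u ^ 3))"
    using has_field_derivative_max_power[of 0] by (simp add: numeral_2_eq_2)
  note 2 = DERIV_chain2[OF this 1]
  have 3: "((\<lambda>u. -9 * u ^ 2) has_field_derivative -18 * u) (at u)"
    by (auto intro!: derivative_eq_intros)
  have "((\<lambda>u. -9 * u ^ 2 * max (m ^ 6 - u ^ 3) 0 ^ 2) has_field_derivative
      54 * u ^ 4 * max (m ^ 6 - u ^ 3) 0 - 18 * u * max (m ^ 6 - u ^ 3) 0 ^ 2) (at u)"
    by (rule DERIV_cong[OF DERIV_mult[OF 3 2]]) (simp add: algebra_simps eval_nat_numeral)
  then show ?thesis unfolding profile'_def profile''_def by (rule DERIV_cdivide)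
qed

text \<open>For \<open>norm y > m\<close> the denominators differ, but both bases vanish and
  \<open>k > 0\<close> makes both quotients \<open>0\<close>. This is what allows \<open>m\<close>
  to be exchanged for \<open>norm0\<close>.\<close>

lemma max_power_diff:
  fixes y :: "'h::real_inner"
  assumes "0 \<le> m" "k > 0"
  shows "(max m (norm y) ^ 6 - norm y ^ 6) ^ k / max m (norm y) ^ 12 = max (m ^ 6 - (y \<bullet> y) ^ 3) 0 ^ k / m ^ 12"
proof -
  have u: "(y \<bullet> y) ^ 3 = norm y ^ 6" by (simp add: dot_square_norm flip: power_mult)
  show ?thesis
  proof (cases "norm y \<le> m")
    case True
    then have "norm y ^ 6 \<le> m ^ 6" by (intro power_mono) auto
    then show ?thesis using True by (simp add: u max_absorb1)
  next
    case False
    then have "m ^ 6 \<le> norm y ^ 6" using assms by (intro power_mono) auto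
    then show ?thesis using False assms by (simp add: u max_absorb2)
  qed
qed

lemma norm_even_powers:
  fixes y :: "'h::real_inner"
  shows "norm y ^ 2 = y \<bullet> y" "norm y ^ 4 = (y \<bullet> y) ^ 2" "norm y ^ 8 = (y \<bullet> y) ^ 4"
  by (simp_all add: dot_square_norm flip: power_mult)

lemma S_val_max:
  "0 \<le> m \<Longrightarrow> S_val (max m (norm y), y) = profile m (y \<bullet> y)"
  using max_power_diff[of m 3 y] by (simp add: S_val_def profile_def)

lemma S_grad_max:
  "0 \<le> m \<Longrightarrow> S_grad (max m (norm y), y) = (2 * profile' m (y \<bullet> y)) *\<^sub>R y"
  using max_power_diff[of m 2 y]
  by (simp add: S_grad_def profile'_def norm_even_powers flip: times_divide_eq_right)

lemma S_hess_max:
  assumes "0 \<le> m"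
  shows "S_hess (max m (norm y), y) =
    (2 * profile' m (y \<bullet> y)) *\<^sub>R id_blinfun + (4 * profile'' m (y \<bullet> y)) *\<^sub>R outer y"
proof -
  have "(max m (norm y) ^ 6 - norm y ^ 6) ^ 2 / max m (norm y) ^ 12 = max (m ^ 6 - (y \<bullet> y) ^ 3) 0 ^ 2 / m ^ 12"
    "(max m (norm y) ^ 6 - norm y ^ 6) / max m (norm y) ^ 12 = max (m ^ 6 - (y \<bullet> y) ^ 3) 0 / m ^ 12"
    using max_power_diff[of m 2 y] max_power_diff[of m 1 y] assms by simp_all
  then show ?thesis
    by (simp only: S_hess_def prod.case norm_even_powers)
      (simp add: profile'_def profile''_def diff_divide_distrib algebra_simps)
qed

lemma GDERIV_S_val:
  fixes x h :: "'h::real_inner"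
  assumes "0 \<le> m"
  shows "GDERIV (\<lambda>h. S_val (max m (norm (x + h)), x + h)) h :> S_grad (max m (norm (x + h)), x + h)"
proof -
  have "GDERIV (\<lambda>h. (x + h) \<bullet> (x + h)) h :> 2 *\<^sub>R (x + h)"
    unfolding gderiv_def by (auto intro!: derivative_eq_intros simp: inner_commute)
  from GDERIV_DERIV_compose[OF this has_field_derivative_profile]
  show ?thesis using assms by (simp add: S_val_max S_grad_max mult.commute)
qed

text \<open>Product rule for the scalar \<open>2 * profile' m u\<close> times \<open>y\<close>:
  differentiating \<open>y\<close> gives the identity term, differentiating the scalar gives the
  rank-one term.\<close>

lemma has_derivative_S_grad:
  fixes x h :: "'h::real_inner"
  assumes "0 \<le> m"
  shows "((\<lambda>h. S_grad (max m (norm (x + h)), x + h)) has_derivative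
    blinfun_apply (S_hess (max m (norm (x + h)), x + h))) (at h)"
proof -
  have q: "((\<lambda>h. (x + h) \<bullet> (x + h)) has_derivative (\<lambda>v. 2 * ((x + h) \<bullet> v))) (at h)"
    by (auto intro!: derivative_eq_intros simp: inner_commute)
  have "((\<lambda>h. profile' m ((x + h) \<bullet> (x + h))) has_derivative
      (\<lambda>v. profile'' m ((x + h) \<bullet> (x + h)) * (2 * ((x + h) \<bullet> v)))) (at h)"
    using has_derivative_compose[OF q has_field_derivative_profile'[unfolded has_field_derivative_def]] .
  then have "((\<lambda>h. (2 * profile' m ((x + h) \<bullet> (x + h))) *\<^sub>R (x + h)) has_derivative
      (\<lambda>v. (2 * profile' m ((x + h) \<bullet> (x + h))) *\<^sub>R v +
           (4 * profile'' m ((x + h) \<bullet> (x + h)) * ((x + h) \<bullet> v)) *\<^sub>R (x + h))) (at h)"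
    by (auto intro!: derivative_eq_intros simp: algebra_simps)
  also have "(\<lambda>v. (2 * profile' m ((x + h) \<bullet> (x + h))) *\<^sub>R v +
      (4 * profile'' m ((x + h) \<bullet> (x + h)) * ((x + h) \<bullet> v)) *\<^sub>R (x + h)) =
      blinfun_apply (S_hess (max m (norm (x + h)), x + h))"
    using assms by (intro ext) (simp add: S_hess_max blinfun.add_left blinfun.scaleR_left)
  finally show ?thesis using assms by (simp add: S_grad_max)
qed

section \<open>Derivatives under a shift of the endpoint\<close>

text \<open>The shift touches only the last value, so the supremum splits into the part over
  \<open>{0..<fst p}\<close>, independent of \<open>h\<close>, and the new endpoint.\<close>

lemma norm0_bump:
  fixes p :: "'h::real_normed_vector path"
  assumes p: "p \<in> Lambda_hat T"
  obtains m where "0 \<le> m" "\<And>h. norm0 (bump p h) = max m (norm (endpoint p + h))"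
proof (cases "fst p = 0")
  case True
  \<comment> \<open>Nothing precedes the endpoint here; \<open>m = 0\<close> replaces the supremum
    over the empty set.\<close>
  then have "norm0 (bump p h) = max 0 (norm (endpoint p + h))" for h
    by (simp add: norm0_def bump_def)
  then show thesis using that[of 0] by blast
next
  case False
  then have t: "0 < fst p" using Lambda_hatD(1)[OF p] by simp
  define m where "m = (SUP s\<in>{0..<fst p}. norm (snd p s))"
  have bdd: "bdd_above ((\<lambda>s. norm (snd p s)) ` {0..<fst p})"
    by (rule bdd_above_mono[OF bdd_above_norm_path[OF p]]) auto
  have "norm (snd p 0) \<le> m" unfolding m_def using bdd t by (intro cSUP_upper) auto
  then have m: "0 \<le> m" using norm_ge_zero order_trans by blast
  have "norm0 (bump p h) = max m (norm (endpoint p + h))" for h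
  proof -
    have "{0..fst p} = insert (fst p) {0..<fst p}" using t by auto
    then have "(\<lambda>s. norm (snd (bump p h) s)) ` {0..fst p} =
        insert (norm (endpoint p + h)) ((\<lambda>s. norm (snd p s)) ` {0..<fst p})"
      by (auto simp: bump_def image_iff)
    then show ?thesis
      using bdd t by (simp add: norm0_def m_def cSup_insert sup_max max.commute bump_def)
  qed
  then show thesis using that m by blast
qed

lemma endpoint_bump [simp]: "endpoint (bump p h) = endpoint p + h"
  by (simp add: endpoint_def bump_def)

lemma bump_0 [simp]: "bump p (0 :: 'h::real_normed_vector) = p"
  by (simp add: endpoint_def bump_def)

text \<open>For fixed \<open>m\<close> the gradient formula holds at every \<open>h\<close>, hence
  near \<open>0\<close> as the second derivative requires; at \<open>h = 0\<close> the maximum is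
  \<open>norm0 p\<close>.\<close>

lemma S_fun_bump:
  fixes p :: "'h::real_inner path"
  assumes p: "p \<in> Lambda_hat T"
  shows "GDERIV (\<lambda>h. S_fun (bump p h)) 0 :> S_grad (norm0 p, endpoint p)"
    and "has_second_derivative_at (\<lambda>h. S_fun (bump p h)) (S_hess (norm0 p, endpoint p)) 0"
proof -
  obtain m where m: "0 \<le> m" "\<And>h. norm0 (bump p h) = max m (norm (endpoint p + h))"
    using norm0_bump[OF p] by blast
  have n: "norm0 p = max m (norm (endpoint p))" using m(2)[of 0] by simp
  have S: "(\<lambda>h. S_fun (bump p h)) = (\<lambda>h. S_val (max m (norm (endpoint p + h)), endpoint p + h))"
    by (simp add: S_fun_eq m)
  show "GDERIV (\<lambda>h. S_fun (bump p h)) 0 :> S_grad (norm0 p, endpoint p)"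
    using GDERIV_S_val[OF m(1), of "endpoint p" 0] by (simp add: S n)
  show "has_second_derivative_at (\<lambda>h. S_fun (bump p h)) (S_hess (norm0 p, endpoint p)) 0"
    unfolding has_second_derivative_at_def S
    using has_derivative_S_grad[OF m(1), of "endpoint p" 0]
    by (intro exI[of _ "\<lambda>h. S_grad (max m (norm (endpoint p + h)), endpoint p + h)"] conjI
        always_eventually allI GDERIV_S_val[OF m(1)]) (simp add: n)
qed

lemma self_adjoint_S_hess: "self_adjoint (S_hess z)"
proof -
  have "self_adjoint (a *\<^sub>R id_blinfun + b *\<^sub>R outer y)" for a b and y :: 'a
    by (simp add: self_adjoint_def blinfun.add_left blinfun.scaleR_left
        inner_add_left inner_add_right inner_commute mult_ac)
  then show ?thesis by (simp only: S_hess_def case_prod_unfold)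
qed

section \<open>Growth bounds and continuity on the cone\<close>

text \<open>Since \<open>0 \<le> b \<le> n\<close>, each numerator lies between \<open>0\<close> and
  the power of \<open>n\<close> of its own degree, from which the denominator removes
  \<open>12\<close>.\<close>

lemma S_coeff_bounds:
  fixes b n :: real
  assumes "0 \<le> b" "b \<le> n"
  shows "\<bar>(n ^ 6 - b ^ 6) ^ 3 / n ^ 12\<bar> \<le> n ^ 6"
    and "\<bar>b ^ 4 * (n ^ 6 - b ^ 6) ^ 2 / n ^ 12\<bar> \<le> n ^ 4"
    and "\<bar>b ^ 2 * (n ^ 6 - b ^ 6) ^ 2 / n ^ 12\<bar> \<le> n ^ 2"
    and "\<bar>b ^ 8 * (n ^ 6 - b ^ 6) / n ^ 12\<bar> \<le> n ^ 2"
proof -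
  define P where "P = n ^ 6 - b ^ 6"
  have n: "0 \<le> n" using assms by simp
  have P: "0 \<le> P" "P \<le> n ^ 6" using assms power_mono[of b n 6] by (auto simp: P_def)
  have quot: "\<bar>x / n ^ 12\<bar> \<le> n ^ k" if "0 \<le> x" "x \<le> n ^ (k + 12)" for x k
  proof (cases "n = 0")
    case False
    then show ?thesis using that n by (simp add: divide_le_eq power_add)
  qed simp
  have "P ^ 3 \<le> (n ^ 6) ^ 3" using P by (intro power_mono) auto
  then show "\<bar>(n ^ 6 - b ^ 6) ^ 3 / n ^ 12\<bar> \<le> n ^ 6"
    using quot[of "P ^ 3" 6] P by (simp add: P_def[symmetric] flip: power_mult)
  have P2: "P ^ 2 \<le> (n ^ 6) ^ 2" using P by (intro power_mono) auto
  have "b ^ k * P ^ 2 \<le> n ^ k * (n ^ 6) ^ 2" for k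
    using assms P2 P by (intro mult_mono power_mono) auto
  then have "b ^ k * P ^ 2 \<le> n ^ (k + 12)" for k by (simp add: power_add flip: power_mult)
  then show "\<bar>b ^ 4 * (n ^ 6 - b ^ 6) ^ 2 / n ^ 12\<bar> \<le> n ^ 4"
      "\<bar>b ^ 2 * (n ^ 6 - b ^ 6) ^ 2 / n ^ 12\<bar> \<le> n ^ 2"
    unfolding P_def[symmetric] using assms(1)
    by (intro quot; simp only: zero_le_power zero_le_power2 mult_nonneg_nonneg)+
  have "b ^ 8 * P \<le> n ^ 8 * n ^ 6" using assms P by (intro mult_mono power_mono) auto
  then have "b ^ 8 * P \<le> n ^ (2 + 12)" by (simp flip: power_add)
  then show "\<bar>b ^ 8 * (n ^ 6 - b ^ 6) / n ^ 12\<bar> \<le> n ^ 2"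
    unfolding P_def[symmetric] using assms P by (intro quot) auto
qed

text \<open>The constant \<open>306\<close> is \<open>18 + 216 + 72\<close>. The factor
  \<open>1\<close> fits the shape \<open>C * fst z ^ k\<close> shared by the continuity and growth
  lemmas.\<close>

lemma norm_S_bounds:
  fixes z :: "real \<times> 'h::real_inner"
  assumes "norm (snd z) \<le> fst z"
  shows "norm (S_val z) \<le> 1 * fst z ^ 6"
    and "norm (S_grad z) \<le> 18 * fst z ^ 5"
    and "norm (S_hess z) \<le> 306 * fst z ^ 4"
proof -
  obtain n y where z: "z = (n, y)" by (cases z)
  define b where "b = norm y"
  have b: "0 \<le> b" "b \<le> n" using assms by (auto simp: z b_def)
  note B = S_coeff_bounds[OF b]
  show "norm (S_val z) \<le> 1 * fst z ^ 6" using B(1) by (simp add: S_val_def z b_def)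
  have "norm (S_grad z) = 18 * (\<bar>b ^ 4 * (n ^ 6 - b ^ 6) ^ 2 / n ^ 12\<bar> * b)"
    by (simp add: S_grad_def z b_def[symmetric] abs_mult)
  also have "\<dots> \<le> 18 * (n ^ 4 * n)" using B(2) b by (intro mult_left_mono mult_mono) auto
  finally show "norm (S_grad z) \<le> 18 * fst z ^ 5" by (simp add: z eval_nat_numeral mult_ac)
  define c1 where "c1 = b ^ 4 * (n ^ 6 - b ^ 6) ^ 2 / n ^ 12"
  define c2 where "c2 = b ^ 8 * (n ^ 6 - b ^ 6) / n ^ 12"
  define c3 where "c3 = b ^ 2 * (n ^ 6 - b ^ 6) ^ 2 / n ^ 12"
  have c: "\<bar>c1\<bar> \<le> n ^ 4" "\<bar>c2\<bar> \<le> n ^ 2" "\<bar>c3\<bar> \<le> n ^ 2"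
    using B by (auto simp: c1_def c2_def c3_def)
  have H: "S_hess z = (- 18 * c1) *\<^sub>R id_blinfun + (216 * c2 - 72 * c3) *\<^sub>R outer y"
    by (simp add: S_hess_def z b_def[symmetric] c1_def c2_def c3_def mult.assoc)
  have "norm (id_blinfun :: 'h \<Rightarrow>\<^sub>L 'h) \<le> 1" by (rule norm_blinfun_bound) auto
  then have 1: "norm ((- 18 * c1) *\<^sub>R (id_blinfun :: 'h \<Rightarrow>\<^sub>L 'h)) \<le> 18 * n ^ 4 * 1"
    unfolding norm_scaleR using c by (intro mult_mono) auto
  have "norm (outer y) \<le> n ^ 2"
    using order_trans[OF norm_outer_le power_mono[of "norm y" n 2]] b by (simp add: b_def)
  then have 2: "norm ((216 * c2 - 72 * c3) *\<^sub>R outer y) \<le> (288 * n ^ 2) * n ^ 2"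
    unfolding norm_scaleR using c by (intro mult_mono) auto
  show "norm (S_hess z) \<le> 306 * fst z ^ 4"
    using norm_triangle_le[OF add_mono[OF 1 2]] unfolding H
    by (simp add: z eval_nat_numeral mult_ac)
qed

text \<open>A point of the cone with first component \<open>0\<close> is the origin; there the
  bound, whose exponent is positive, squeezes \<open>g\<close> to \<open>0\<close>.\<close>

lemma continuous_on_cone:
  fixes g :: "real \<times> 'h::real_normed_vector \<Rightarrow> 'b::real_normed_vector"
  assumes g: "continuous_on {z. fst z \<noteq> 0} g"
    and bd: "\<And>z. norm (snd z) \<le> fst z \<Longrightarrow> norm (g z) \<le> C * fst z ^ Suc k"
  shows "continuous_on {z. norm (snd z) \<le> fst z} g"
  unfolding continuous_on
proof
  fix z :: "real \<times> 'h"
  assume z: "z \<in> {z. norm (snd z) \<le> fst z}"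
  show "(g \<longlongrightarrow> g z) (at z within {z. norm (snd z) \<le> fst z})"
  proof (cases "fst z = 0")
    case False
    have "open {z :: real \<times> 'h. fst z \<noteq> 0}"
      by (intro open_Collect_neq continuous_intros)
    then have "isCont g z" using g False by (cases z) (simp add: continuous_on_eq_continuous_at)
    then show ?thesis using continuous_at_imp_continuous_within continuous_within by blast
  next
    case True
    then have gz: "g z = 0" using bd[of z] z by simp
    have "((\<lambda>z. C * fst z ^ Suc k) \<longlongrightarrow> C * fst z ^ Suc k) (at z within {z. norm (snd z) \<le> fst z})"
      by (intro tendsto_intros)
    then have "((\<lambda>z. C * fst z ^ Suc k) \<longlongrightarrow> 0) (at z within {z. norm (snd z) \<le> fst z})"
      using True by simp
    then have "(g \<longlongrightarrow> 0) (at z within {z. norm (snd z) \<le> fst z})"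
      by (rule Lim_null_comparison[rotated]) (use bd in \<open>auto simp: eventually_at_filter\<close>)
    then show ?thesis by (simp add: gz)
  qed
qed

lemma continuous_on_S:
  "continuous_on {z. norm (snd z) \<le> fst z} (S_val :: real \<times> 'h::real_inner \<Rightarrow> real)"
  "continuous_on {z. norm (snd z) \<le> fst z} (S_grad :: real \<times> 'h \<Rightarrow> 'h)"
  "continuous_on {z. norm (snd z) \<le> fst z} (S_hess :: real \<times> 'h \<Rightarrow> 'h \<Rightarrow>\<^sub>L 'h)"
proof -
  show "continuous_on {z. norm (snd z) \<le> fst z} (S_val :: real \<times> 'h \<Rightarrow> real)"
    by (rule continuous_on_cone[where C = 1 and k = 5])
      (use norm_S_bounds(1) in \<open>auto simp: S_val_def case_prod_unfold intro!: continuous_intros\<close>)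
  show "continuous_on {z. norm (snd z) \<le> fst z} (S_grad :: real \<times> 'h \<Rightarrow> 'h)"
    by (rule continuous_on_cone[where C = 18 and k = 4])
      (use norm_S_bounds(2) in \<open>auto simp: S_grad_def case_prod_unfold intro!: continuous_intros\<close>)
  show "continuous_on {z. norm (snd z) \<le> fst z} (S_hess :: real \<times> 'h \<Rightarrow> 'h \<Rightarrow>\<^sub>L 'h)"
    by (rule continuous_on_cone[where C = 306 and k = 3])
      (use norm_S_bounds(3) in \<open>auto simp: S_hess_def case_prod_unfold intro!: continuous_intros\<close>)
qed

lemma polynomial_growth_comp:
  fixes g :: "real \<times> 'h::real_normed_vector \<Rightarrow> 'b::real_normed_vector"
  assumes bd: "\<And>z. norm (snd z) \<le> fst z \<Longrightarrow> norm (g z) \<le> C * fst z ^ k" and C: "0 \<le> C"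
  shows "polynomial_growth T (\<lambda>p. g (norm0 p, endpoint p))"
  unfolding polynomial_growth_def
proof (intro exI ballI)
  fix p :: "'h path" assume p: "p \<in> Lambda_hat T"
  show "norm (g (norm0 p, endpoint p)) \<le> C * (1 + norm0 p ^ k)"
    using bd[of "(norm0 p, endpoint p)"] norm_endpoint_le_norm0[OF p] C by (simp add: algebra_simps)
qed

section \<open>Time derivative and membership in the smooth class\<close>

lemma S_fun_flat_ext:
  fixes p :: "'h::real_inner path"
  assumes "p \<in> Lambda_hat T" "0 < h"
  shows "S_fun (flat_ext p (fst p + h)) = S_fun p"
proof -
  have "(\<lambda>s. norm (snd (flat_ext p (fst p + h)) s)) ` {0..fst p + h} = (\<lambda>s. norm (snd p s)) ` {0..fst p}"
    (is "?L = ?R")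
  proof
    show "?L \<subseteq> ?R" using assms Lambda_hatD(1)[OF assms(1)]
      by (auto simp: flat_ext_def endpoint_def)
    show "?R \<subseteq> ?L"
    proof
      fix x assume "x \<in> ?R"
      then obtain s where "s \<in> {0..fst p}" "x = norm (snd p s)" by blast
      then show "x \<in> ?L" using assms by (intro image_eqI[of _ _ s]) (auto simp: flat_ext_def)
    qed
  qed
  then have "norm0 (flat_ext p (fst p + h)) = norm0 p"
    unfolding norm0_def by (simp add: flat_ext_def)
  moreover have "endpoint (flat_ext p (fst p + h)) = endpoint p"
    using assms Lambda_hatD(1)[OF assms(1)] by (simp add: flat_ext_def endpoint_def)
  ultimately show ?thesis by (simp add: S_fun_eq)
qed

lemma has_path_time_derivative_S_fun:
  "has_path_time_derivative T (S_fun :: 'h::real_inner path \<Rightarrow> real) (\<lambda>_. 0)"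
  unfolding has_path_time_derivative_def
proof (intro conjI ballI impI)
  fix p :: "'h path" assume p: "p \<in> Lambda_hat T"
  have "\<forall>\<^sub>F h in at_right 0. 0 = (S_fun (flat_ext p (fst p + h)) - S_fun p) / h"
    by (auto simp: eventually_at_filter S_fun_flat_ext[OF p])
  with tendsto_const show "((\<lambda>h. (S_fun (flat_ext p (fst p + h)) - S_fun p) / h) \<longlongrightarrow> 0) (at_right 0)"
    by (rule Lim_transform_eventually)
qed simp

lemma S_fun_in_C12p:
  fixes E :: "real \<Rightarrow> 'h::{real_inner, banach} \<Rightarrow>\<^sub>L 'h"
  assumes "C0_semigroup E"
  shows "(S_fun :: 'h path \<Rightarrow> real) \<in> C12p T E"
proof -
  let ?fx = "\<lambda>p :: 'h path. S_grad (norm0 p, endpoint p)"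
  let ?fxx = "\<lambda>p :: 'h path. S_hess (norm0 p, endpoint p)"
  have S: "(S_fun :: 'h path \<Rightarrow> real) = (\<lambda>p. S_val (norm0 p, endpoint p))"
    by (simp add: fun_eq_iff S_fun_eq)
  have "has_path_space_derivative T S_fun ?fx"
    "has_path_second_space_derivative T S_fun ?fxx"
    unfolding has_path_space_derivative_def has_path_second_space_derivative_def
    using S_fun_bump self_adjoint_S_hess by blast+
  moreover have "d_inf_continuous T E (S_fun :: 'h path \<Rightarrow> real)"
    "d_inf_continuous T E ?fx" "d_inf_continuous T E ?fxx"
    unfolding S using d_inf_continuous_comp[OF assms] continuous_on_S by blast+
  moreover have "d_inf_continuous T E (\<lambda>_ :: 'h path. 0 :: real)"
    by (auto simp: d_inf_continuous_def intro: exI[of _ 1])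
  moreover have "polynomial_growth T (S_fun :: 'h path \<Rightarrow> real)"
    "polynomial_growth T ?fx" "polynomial_growth T ?fxx"
    unfolding S using polynomial_growth_comp[OF norm_S_bounds(1)]
      polynomial_growth_comp[OF norm_S_bounds(2)] polynomial_growth_comp[OF norm_S_bounds(3)] by simp_all
  moreover have "polynomial_growth T (\<lambda>_ :: 'h path. 0 :: real)"
    by (auto simp: polynomial_growth_def intro: exI[of _ 0])
  ultimately show ?thesis
    using has_path_time_derivative_S_fun unfolding C12p_def by blast
qed

section \<open>Two-sided estimate of \<open>Upsilon\<close>\<close>

text \<open>In terms of the sixth powers \<open>a\<close> and \<open>c\<close> the functional is
  \<open>(a - c) ^ 3 / a ^ 2 + M * c\<close> with \<open>0 \<le> c \<le> a\<close>. The lower bound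
  reduces to \<open>M = 1\<close>, the upper one estimates both summands separately.\<close>

lemma Upsilon_bounds:
  fixes p :: "'h::real_inner path"
  assumes p: "p \<in> Lambda_hat T" and M: "M \<ge> 1"
  shows "8 / 27 * norm0 p ^ 6 \<le> Upsilon M p" "Upsilon M p \<le> (M + 1) * norm0 p ^ 6"
proof -
  define a where "a = norm0 p ^ 6"
  define c where "c = norm (endpoint p) ^ 6"
  have c: "0 \<le> c" "c \<le> a"
    using norm_endpoint_le_norm0[OF p] by (auto simp: a_def c_def intro: power_mono)
  have U: "Upsilon M p = (a - c) ^ 3 / a ^ 2 + M * c"
    by (simp add: Upsilon_def S_fun_eq S_val_def a_def c_def flip: power_mult)
  have "c \<le> M * c" using mult_right_mono[OF M c(1)] by simp
  have nn: "0 \<le> (a - c) ^ 3 / a ^ 2" using c by simp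
  have "8 / 27 * a \<le> (a - c) ^ 3 / a ^ 2 + c"
  \<comment> \<open>Either \<open>c\<close> alone is at least \<open>a / 3\<close>, which exceeds
    \<open>8 / 27 * a\<close> unless \<open>a = 0\<close>, or \<open>a - c\<close> is at least
    \<open>2 / 3 * a\<close>, whose cube gives \<open>8 / 27\<close>.\<close>
  proof (cases "a \<le> 3 * c")
    case True
    then have "8 / 27 * a \<le> c" using c by linarith
    then show ?thesis using nn by linarith
  next
    case False
    have "(2 / 3 * a) ^ 3 \<le> (a - c) ^ 3" using False c by (intro power_mono) auto
    then have "8 / 27 * a \<le> (a - c) ^ 3 / a ^ 2"
      using False c by (simp add: le_divide_eq power2_eq_square power3_eq_cube)
    then show ?thesis using c by simp
  qed
  then show "8 / 27 * norm0 p ^ 6 \<le> Upsilon M p"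
    using \<open>c \<le> M * c\<close> by (simp add: U a_def)
  have "(a - c) ^ 3 \<le> a ^ 3" using c by (intro power_mono) auto
  then have "(a - c) ^ 3 / a ^ 2 \<le> a"
    using c by (cases "a = 0") (auto simp: divide_le_eq power2_eq_square power3_eq_cube)
  moreover have "M * c \<le> M * a" using c M by (intro mult_left_mono) auto
  ultimately show "Upsilon M p \<le> (M + 1) * norm0 p ^ 6"
    by (simp add: U a_def algebra_simps)
qed

theorem lemma2p10:
  fixes T :: real
    and D :: "'h::{real_inner, banach} set"
    and A :: "'h \<Rightarrow> 'h"
    and E :: "real \<Rightarrow> 'h \<Rightarrow>\<^sub>L 'h"
  assumes "separable_space (euclidean :: 'h topology)"
    and "T > 0"
    and "generates_C0_semigroup D A E"
  shows "(S_fun :: 'h path \<Rightarrow> real) \<in> C12p T E \<and>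
    (\<forall>M\<ge>1. \<forall>p\<in>(Lambda_hat T :: 'h path set).
       8 / 27 * norm0 p ^ 6 \<le> Upsilon M p \<and> Upsilon M p \<le> (M + 1) * norm0 p ^ 6)"
  using S_fun_in_C12p Upsilon_bounds assms(3) unfolding generates_C0_semigroup_def by blast

end
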